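(* For every fixed integer $r\ge 2$, $$bt^{(r)}(n)=(1+o(1))\,\frac{\log n}{\log\log n}\qquad\text{as } n\to\infty,$$ where the term $o(1)$ may depend on $r$.
   Context: A permutation is any finite sequence of distinct integers; a permutation of $[n]=\{1,\dots,n\}$ is one whose set of entries is $[n]$. Two permutations $(x_1,\dots,x_k)$ and $(y_1,\dots,y_k)$ of the same length are similar if $x_i<x_j$ if and only if $y_i<y_j$ for all $1\le i<j\le k$. A block in a permutation $\pi$ is a subsequence of $\pi$ occupying a non-empty segment of consecutive positions. For an integer $r\ge2$, a collection of $r$ pairwise disjoint (occupying pairwise disjoint sets of positions), pairwise similar blocks in $\pi$, each of length $k$, forms block $r$-twins of length $k$ in $\pi$. Let $bt^{(r)}(\pi)$ be the largest $k$ such that $\pi$ contains block $r$-twins of length $k$, and let $bt^{(r)}(n)=\min\{bt^{(r)}(\pi):\pi \text{ is a permutation of } [n]\}$. *)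

theory Defs
  imports
    Complex_Main
    "HOL-Library.Landau_Symbols"
    "HOL-Combinatorics.Multiset_Permutations"
begin

text \<open>
  A permutation is a finite sequence of distinct integers, represented as a distinct
  \<^typ>\<open>int list\<close>; the permutations of \<open>[n]\<close> are the elements of
  \<^term>\<open>permutations_of_set {1..int n}\<close>. Positions are counted from 0.
\<close>

definition similar :: "int list \<Rightarrow> int list \<Rightarrow> bool" where
  "similar xs ys \<longleftrightarrow> length xs = length ys \<and>
     (\<forall>i j. i < j \<and> j < length xs \<longrightarrow> (xs ! i < xs ! j \<longleftrightarrow> ys ! i < ys ! j))"

text \<open>
  \<open>block xs s k\<close> is the block of \<open>xs\<close> occupying the positions \<open>{s..<s + k}\<close>; this makes
  sense only for \<open>s + k \<le> length xs\<close>.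
\<close>

definition block :: "int list \<Rightarrow> nat \<Rightarrow> nat \<Rightarrow> int list" where
  "block xs s k = take k (drop s xs)"

text \<open>
  A collection of \<open>r\<close> blocks of length \<open>k\<close> is given by the set \<open>S\<close> of their starting
  positions.
\<close>

definition has_block_twins :: "nat \<Rightarrow> nat \<Rightarrow> int list \<Rightarrow> bool" where
  "has_block_twins r k xs \<longleftrightarrow> k \<ge> 1 \<and>
     (\<exists>S. finite S \<and> card S = r \<and>
          (\<forall>s\<in>S. s + k \<le> length xs) \<and>
          pairwise (\<lambda>s t. {s..<s + k} \<inter> {t..<t + k} = {}) S \<and>
          pairwise (\<lambda>s t. similar (block xs s k) (block xs t k)) S)"

text \<open>
  The supremum is a maximum as soon as \<open>r \<le> length xs\<close> (lemma \<open>bt_attained\<close> below). For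
  shorter sequences there are no block twins at all, and the value is 0.
\<close>

definition bt :: "nat \<Rightarrow> int list \<Rightarrow> nat" where
  "bt r xs = Sup {k. has_block_twins r k xs}"

definition bt_min :: "nat \<Rightarrow> nat \<Rightarrow> nat" where
  "bt_min r n = Min (bt r ` permutations_of_set {1..int n})"

lemma finite_block_twins_lengths:
  assumes "r \<ge> 1"
  shows "finite {k. has_block_twins r k xs}"
proof (rule finite_subset)
  show "{k. has_block_twins r k xs} \<subseteq> {..length xs}"
  proof
    fix k assume "k \<in> {k. has_block_twins r k xs}"
    then obtain S where S: "card S = r" "\<forall>s\<in>S. s + k \<le> length xs"
      by (auto simp: has_block_twins_def)
    from S(1) assms have "S \<noteq> {}" by auto
    then obtain s where "s \<in> S" by blast
    with S(2) have "s + k \<le> length xs" by blast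
    then show "k \<in> {..length xs}" by simp
  qed
qed simp

lemma has_block_twins_1:
  assumes "r \<le> length xs"
  shows "has_block_twins r 1 xs"
  unfolding has_block_twins_def
proof (intro conjI exI)
  show "pairwise (\<lambda>s t. similar (block xs s 1) (block xs t 1)) {..<r}"
    using assms by (auto simp: pairwise_def similar_def block_def)
qed (use assms in \<open>auto simp: pairwise_def\<close>)

lemma bt_attained:
  assumes "1 \<le> r" "r \<le> length xs"
  shows "has_block_twins r (bt r xs) xs"
    and "\<And>k. has_block_twins r k xs \<Longrightarrow> k \<le> bt r xs"
proof -
  let ?K = "{k. has_block_twins r k xs}"
  have fin: "finite ?K" and ne: "?K \<noteq> {}"
    using finite_block_twins_lengths[OF assms(1)] has_block_twins_1[OF assms(2)] by auto
  have "bt r xs = Max ?K"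
    by (simp only: bt_def Sup_nat_def ne if_False)
  then show "has_block_twins r (bt r xs) xs"
    and "\<And>k. has_block_twins r k xs \<Longrightarrow> k \<le> bt r xs"
    using Max_in[OF fin ne] Max_ge[OF fin] by auto
qed

end

theory Submission
  imports Defs "HOL-Real_Asymp.Real_Asymp"
begin

text \<open>
  Both bounds compare \<open>n\<close> with the number \<open>k!\<close> of patterns of length \<open>k\<close>.

  If \<open>r k k! \<le> n\<close>, cut a permutation of \<open>[n]\<close> into consecutive blocks of length \<open>k\<close>. There are at
  least \<open>r k!\<close> of them, so some \<open>r\<close> share their pattern, and hence \<open>k \<le> bt_min r n\<close>
  (lemma \<open>bt_min_ge\<close>).

  Conversely, let \<open>n 2\<^sup>k \<le> k!\<close>. The claim is that some permutation of \<open>[n]\<close> has no two disjoint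
  similar blocks of length \<open>k\<close>; truncating blocks shows that it has no longer twins either. A union
  bound over the roughly \<open>n\<^sup>2\<close> pairs of blocks would only allow \<open>n\<close> of order \<open>\<surd>(k!)\<close> and lose a
  factor of 2 in the theorem. Instead, let \<open>g m\<close> count the twin-free permutations of \<open>[m]\<close>, and prove
  by induction that \<open>(m + 1) g m \<le> 2 g (m + 1)\<close>, i.e. that at least half of all the ways to append
  an entry to a twin-free permutation keep it twin-free. An extension that fails contains twins whose
  second block is its last block. It is therefore determined by the starting position of the first
  block, by the pattern of the \<open>m + 1 - k\<close> entries before the last block, which is twin-free, and by
  the set of values in the last block. This leaves at most
  \<open>(m + 1) g (m + 1 - k) (m + 1 choose k)\<close> failures (lemma \<open>card_spoiled_extensions_le\<close>), and by
  the induction hypothesis \<open>g (m + 1 - k)\<close> is small enough relative to \<open>g m\<close> for this to be at most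
  half of \<open>(m + 1) g m\<close> (lemma \<open>twin_free_perms_growth\<close>). So \<open>g n\<close> is positive and
  \<open>bt_min r n < k\<close> (lemma \<open>bt_min_less\<close>).

  Since \<open>ln (k!)\<close> is \<open>k ln k\<close> up to an error of order \<open>k\<close>, both conditions on \<open>k\<close> change from true
  to false, or from false to true, at \<open>k = (1 + o(1)) ln n / ln (ln n)\<close>.
\<close>

section \<open>Similarity and standardization\<close>

lemma similar_refl [simp]: "similar xs xs"
  by (simp add: similar_def)

lemma similar_sym: "similar xs ys \<Longrightarrow> similar ys xs"
  by (auto simp: similar_def)

lemma similar_trans: "similar xs ys \<Longrightarrow> similar ys zs \<Longrightarrow> similar xs zs"
  by (auto simp: similar_def)

lemma similar_length: "similar xs ys \<Longrightarrow> length xs = length ys"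
  by (simp add: similar_def)

lemma similar_take: "similar xs ys \<Longrightarrow> similar (take m xs) (take m ys)"
  by (auto simp: similar_def)

lemma similar_drop: "similar xs ys \<Longrightarrow> similar (drop m xs) (drop m ys)"
  by (auto simp: similar_def less_diff_conv add.commute)

lemma similar_block: "similar xs ys \<Longrightarrow> similar (block xs s k) (block ys s k)"
  by (simp add: block_def similar_take similar_drop)

text \<open>
  Similarity only compares positions in increasing order; for distinct entries it preserves all
  comparisons, because a failed comparison is then a strict comparison the other way round.
\<close>

lemma similar_nth_less_iff:
  assumes "similar xs ys" "distinct xs" "distinct ys" "i < length xs" "j < length xs"
  shows "xs ! i < xs ! j \<longleftrightarrow> ys ! i < ys ! j"
proof (cases i j rule: linorder_cases)
  case greater
  then have "xs ! j < xs ! i \<longleftrightarrow> ys ! j < ys ! i" "xs ! j \<noteq> xs ! i" "ys ! j \<noteq> ys ! i"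
    using assms by (auto simp: similar_def nth_eq_iff_index_eq)
  then show ?thesis by linarith
qed (use assms in \<open>auto simp: similar_def\<close>)

lemma similar_map_strict_mono_on:
  assumes "strict_mono_on (set xs) f"
  shows "similar (map f xs) xs"
  using strict_mono_on_less[OF assms] by (auto simp: similar_def)

definition rank_in :: "int set \<Rightarrow> int \<Rightarrow> nat" where
  "rank_in A x = card {y\<in>A. y < x}"

lemma strict_mono_on_rank_in:
  assumes "finite A"
  shows "strict_mono_on A (rank_in A)"
proof (rule strict_mono_onI)
  fix x y assume "x \<in> A" "y \<in> A" "x < y"
  then have "{z\<in>A. z < x} \<subset> {z\<in>A. z < y}" by auto
  then show "rank_in A x < rank_in A y"
    unfolding rank_in_def using assms by (intro psubset_card_mono) auto
qed

lemma rank_in_set_nth: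
  assumes "distinct xs"
  shows "rank_in (set xs) (xs ! i) = card {j. j < length xs \<and> xs ! j < xs ! i}"
proof -
  have "{y \<in> set xs. y < xs ! i} = (!) xs ` {j. j < length xs \<and> xs ! j < xs ! i}"
    by (auto simp: set_conv_nth)
  moreover have "inj_on ((!) xs) {j. j < length xs \<and> xs ! j < xs ! i}"
    using assms by (auto simp: inj_on_def nth_eq_iff_index_eq)
  ultimately show ?thesis by (simp add: rank_in_def card_image)
qed

lemma similar_rank_in_eq:
  assumes "similar xs ys" "distinct xs" "distinct ys" "i < length xs"
  shows "rank_in (set xs) (xs ! i) = rank_in (set ys) (ys ! i)"
proof -
  have "{j. j < length xs \<and> xs ! j < xs ! i} = {j. j < length ys \<and> ys ! j < ys ! i}"
    using similar_nth_less_iff[OF assms(1-3) _ assms(4)] similar_length[OF assms(1)] by auto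
  then show ?thesis using assms by (simp add: rank_in_set_nth)
qed

text \<open>
  A pattern together with the set of entries determines a permutation: similarity fixes the
  rank of every entry, and ranks within a finite set are injective.
\<close>

lemma similar_imp_eq:
  assumes "similar xs ys" "distinct xs" "distinct ys" "set xs = set ys"
  shows "xs = ys"
proof (rule nth_equalityI)
  show len: "length xs = length ys" using assms(1) by (rule similar_length)
  fix i assume i: "i < length xs"
  have "rank_in (set xs) (xs ! i) = rank_in (set xs) (ys ! i)"
    using similar_rank_in_eq[OF assms(1-3) i] assms(4) by simp
  moreover have "inj_on (rank_in (set xs)) (set xs)"
    by (intro strict_mono_on_imp_inj_on strict_mono_on_rank_in) simp
  moreover have "xs ! i \<in> set xs" using i by simp
  moreover have "ys ! i \<in> set xs" using i len assms(4) by simp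
  ultimately show "xs ! i = ys ! i" by (auto dest: inj_onD)
qed

text \<open>
  The canonical representative of the similarity class, a permutation of \<open>[length xs]\<close>. It makes
  patterns countable: the patterns of length \<open>k\<close> become the \<open>k!\<close> permutations of \<open>[k]\<close>.
\<close>

definition standardize :: "int list \<Rightarrow> int list" where
  "standardize xs = map (\<lambda>x. 1 + int (rank_in (set xs) x)) xs"

lemma similar_standardize: "similar (standardize xs) xs"
  unfolding standardize_def
proof (rule similar_map_strict_mono_on)
  show "strict_mono_on (set xs) (\<lambda>x. 1 + int (rank_in (set xs) x))"
    using strict_mono_on_rank_in[of "set xs"] by (auto simp: strict_mono_on_def)
qed

lemma length_standardize [simp]: "length (standardize xs) = length xs"
  by (simp add: standardize_def)

lemma standardize_in_permutations:
  assumes "distinct xs"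
  shows "standardize xs \<in> permutations_of_set {1..int (length xs)}"
proof -
  have inj: "inj_on (\<lambda>x. 1 + int (rank_in (set xs) x)) (set xs)"
    using strict_mono_on_imp_inj_on[OF strict_mono_on_rank_in[of "set xs"]]
    by (auto simp: inj_on_def)
  then have dist: "distinct (standardize xs)"
    using assms by (simp add: standardize_def distinct_map)
  have sub: "set (standardize xs) \<subseteq> {1..int (length xs)}"
  proof
    fix v assume "v \<in> set (standardize xs)"
    then obtain x where x: "x \<in> set xs" "v = 1 + int (rank_in (set xs) x)"
      by (auto simp: standardize_def)
    have "{y \<in> set xs. y < x} \<subset> set xs" using x(1) by auto
    then have "rank_in (set xs) x < card (set xs)"
      unfolding rank_in_def by (intro psubset_card_mono) simp_all
    also have "\<dots> = length xs" using assms by (rule distinct_card)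
    finally have "rank_in (set xs) x < length xs" .
    then show "v \<in> {1..int (length xs)}" using x(2) by simp
  qed
  have "set (standardize xs) = {1..int (length xs)}"
    using distinct_card[OF dist] by (intro card_subset_eq sub) auto
  with dist show ?thesis by (simp add: permutations_of_set_def)
qed

lemma distinct_block: "distinct xs \<Longrightarrow> distinct (block xs s k)"
  by (simp add: block_def)

lemma length_block: "s + k \<le> length xs \<Longrightarrow> length (block xs s k) = k"
  by (simp add: block_def)

section \<open>Twins forced by the pigeonhole principle\<close>

text \<open>
  The first \<open>r k!\<close> blocks starting at multiples of \<open>k\<close> are pairwise disjoint and have only \<open>k!\<close>
  possible patterns.
\<close>

lemma has_block_twins_pigeonhole:
  assumes dist: "distinct xs" and k: "k \<ge> 1" and r: "r \<ge> 1" and len: "r * k * fact k \<le> length xs"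
  shows "has_block_twins r k xs"
proof -
  define N where "N = r * fact k"
  have fits: "i * k + k \<le> length xs" if "i < N" for i
  proof -
    have "i * k + k = Suc i * k" by simp
    also have "\<dots> \<le> N * k" using that by (intro mult_right_mono) auto
    also have "\<dots> \<le> length xs" using len by (simp add: N_def ac_simps)
    finally show ?thesis .
  qed
  define p where "p i = standardize (block xs (i * k) k)" for i
  let ?P = "permutations_of_set {1..int k}"
  have p_in: "p i \<in> ?P" if "i < N" for i
    using standardize_in_permutations[OF distinct_block[OF dist]] length_block[OF fits[OF that]]
    unfolding p_def by metis
  have "\<exists>\<tau>\<in>?P. r \<le> card {i. i < N \<and> p i = \<tau>}"
  proof (rule ccontr)
    assume "\<not> ?thesis"
    then have small: "card {i. i < N \<and> p i = \<tau>} \<le> r - 1" if "\<tau> \<in> ?P" for \<tau>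
      using that by force
    have "{..<N} = (\<Union>\<tau>\<in>?P. {i. i < N \<and> p i = \<tau>})" using p_in by auto
    then have "N \<le> (\<Sum>\<tau>\<in>?P. card {i. i < N \<and> p i = \<tau>})"
      using card_UN_le[of ?P "\<lambda>\<tau>. {i. i < N \<and> p i = \<tau>}"] by (metis card_lessThan finite_permutations_of_set)
    also have "\<dots> \<le> (\<Sum>\<tau>\<in>?P. r - 1)" by (intro sum_mono small)
    also have "\<dots> = fact k * (r - 1)" by simp
    also have "\<dots> < N" using r by (simp add: N_def mult.commute)
    finally show False by simp
  qed
  then obtain \<tau> where "r \<le> card {i. i < N \<and> p i = \<tau>}" by blast
  then obtain I where I: "I \<subseteq> {i. i < N \<and> p i = \<tau>}" "card I = r" "finite I"
    by (rule obtain_subset_with_card_n)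
  have inj: "inj_on (\<lambda>i. i * k) I" using k by (auto simp: inj_on_def)
  have sim: "similar (block xs (i * k) k) (block xs (j * k) k)" if "i \<in> I" "j \<in> I" for i j
  proof -
    have "p i = p j" using that I(1) by auto
    then show ?thesis
      unfolding p_def using similar_standardize similar_sym similar_trans by metis
  qed
  have disj: "{i * k..<i * k + k} \<inter> {j * k..<j * k + k} = {}" if "i \<noteq> j" for i j
  proof -
    have *: "a * k + k \<le> b * k" if "a < b" for a b
    proof -
      have "a * k + k = Suc a * k" by simp
      also have "\<dots> \<le> b * k" using that by (intro mult_right_mono) auto
      finally show ?thesis .
    qed
    show ?thesis
      using that *[of i j] *[of j i] by (cases i j rule: linorder_cases) fastforce+
  qed
  show ?thesis
    unfolding has_block_twins_def
  proof (intro conjI exI[of _ "(\<lambda>i. i * k) ` I"] ballI)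
    show "card ((\<lambda>i. i * k) ` I) = r" using inj I(2) by (simp add: card_image)
    show "pairwise (\<lambda>s t. {s..<s + k} \<inter> {t..<t + k} = {}) ((\<lambda>i. i * k) ` I)"
    proof (rule pairwiseI)
      fix s t assume "s \<in> (\<lambda>i. i * k) ` I" "t \<in> (\<lambda>i. i * k) ` I" "s \<noteq> t"
      then obtain i j where ij: "s = i * k" "t = j * k" "i \<noteq> j" by blast
      show "{s..<s + k} \<inter> {t..<t + k} = {}" unfolding ij(1,2) using ij(3) by (rule disj)
    qed
    show "pairwise (\<lambda>s t. similar (block xs s k) (block xs t k)) ((\<lambda>i. i * k) ` I)"
      using sim by (auto intro!: pairwiseI)
    show "s + k \<le> length xs" if "s \<in> (\<lambda>i. i * k) ` I" for s using that I(1) fits by auto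
  qed (use k I in auto)
qed

lemma length_permutation:
  "xs \<in> permutations_of_set {1..int n} \<Longrightarrow> length xs = n"
  using length_finite_permutations_of_set by fastforce

lemma bt_min_ge:
  assumes "k \<ge> 1" "r \<ge> 1" "r * k * fact k \<le> n"
  shows "k \<le> bt_min r n"
proof -
  have "k \<le> bt r xs" if xs: "xs \<in> permutations_of_set {1..int n}" for xs
  proof (rule bt_attained(2))
    have len: "length xs = n" using xs by (rule length_permutation)
    have "r * 1 \<le> r * (k * fact k)" using assms(1) by (intro mult_left_mono) (simp_all add: Suc_leI)
    also have "\<dots> \<le> length xs" using assms(3) len by (simp only: mult.assoc)
    finally show "r \<le> length xs" by simp
    show "has_block_twins r k xs"
      using assms xs len by (intro has_block_twins_pigeonhole) (auto dest: permutations_of_setD)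
  qed (fact assms(2))
  then show ?thesis unfolding bt_min_def by (subst Min_ge_iff) auto
qed

section \<open>Permutations without twins, by counting\<close>

text \<open>
  Two disjoint blocks of equal length can be listed from left to right, so block 2-twins are a
  pair of starting positions \<open>s\<close>, \<open>t\<close> with \<open>s + k \<le> t\<close>.
\<close>

definition twin_free :: "nat \<Rightarrow> int list \<Rightarrow> bool" where
  "twin_free k xs \<longleftrightarrow>
     (\<forall>s t. s + k \<le> t \<and> t + k \<le> length xs \<longrightarrow> \<not> similar (block xs s k) (block xs t k))"

definition twin_free_perms :: "nat \<Rightarrow> nat \<Rightarrow> int list set" where
  "twin_free_perms k m = {xs \<in> permutations_of_set {1..int m}. twin_free k xs}"

lemma finite_twin_free_perms [simp]: "finite (twin_free_perms k m)"
  by (simp add: twin_free_perms_def)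

lemma twin_free_similar:
  assumes "similar xs ys" "twin_free k xs"
  shows "twin_free k ys"
  unfolding twin_free_def
proof (intro allI impI notI)
  fix s t assume st: "s + k \<le> t \<and> t + k \<le> length ys" and "similar (block ys s k) (block ys t k)"
  then have "similar (block xs s k) (block xs t k)"
    using similar_block[OF assms(1)] similar_trans similar_sym by metis
  with st assms(2) similar_length[OF assms(1)] show False by (auto simp: twin_free_def)
qed

lemma block_take: "s + k \<le> m \<Longrightarrow> block (take m xs) s k = block xs s k"
  by (simp add: block_def drop_take min_def)

lemma twin_free_take:
  assumes "twin_free k xs"
  shows "twin_free k (take m xs)"
  unfolding twin_free_def
proof (intro allI impI)
  fix s t assume "s + k \<le> t \<and> t + k \<le> length (take m xs)"
  then show "\<not> similar (block (take m xs) s k) (block (take m xs) t k)"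
    using assms by (simp add: twin_free_def block_take)
qed

text \<open>
  Appends \<open>v\<close> and makes room for it by shifting up the entries that are at least \<open>v\<close>, which keeps
  the pattern of the old entries. Every permutation of \<open>[m + 1]\<close> arises in this way from a unique
  permutation of \<open>[m]\<close> and a unique \<open>v\<close> in \<open>[m + 1]\<close>.
\<close>

definition extend :: "int list \<times> int \<Rightarrow> int list" where
  "extend = (\<lambda>(xs, v). map (\<lambda>x. if x < v then x else x + 1) xs @ [v])"

lemma inj_extend: "inj extend"
proof (rule injI)
  fix a b assume eq: "extend a = extend b"
  obtain xs v ys w where ab: "a = (xs, v)" "b = (ys, w)" by (cases a, cases b)
  have vw: "w = v" and m: "map (\<lambda>x. if x < v then x else x + 1) xs = map (\<lambda>x. if x < v then x else x + 1) ys"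
    using eq by (auto simp: extend_def ab)
  have "inj (\<lambda>x::int. if x < v then x else x + 1)" by (auto simp: inj_def split: if_splits)
  with m have "xs = ys" by (simp add: inj_map_eq_map)
  with vw show "a = b" by (simp add: ab)
qed

lemma extend_in_permutations:
  assumes "xs \<in> permutations_of_set {1..int m}" "v \<in> {1..int (Suc m)}"
  shows "extend (xs, v) \<in> permutations_of_set {1..int (Suc m)}"
    and "similar (take m (extend (xs, v))) xs"
proof -
  let ?f = "\<lambda>x::int. if x < v then x else x + 1"
  have xs: "distinct xs" "set xs = {1..int m}" using permutations_of_setD[OF assms(1)] by auto
  have len: "length xs = m" using assms(1) by (rule length_permutation)
  have inj: "inj_on ?f (set xs)" by (auto simp: inj_on_def split: if_splits)
  have dist: "distinct (extend (xs, v))"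
    using xs(1) inj by (auto simp: extend_def distinct_map)
  have sub: "set (extend (xs, v)) \<subseteq> {1..int (Suc m)}" using xs(2) assms(2) by (auto simp: extend_def)
  have "set (extend (xs, v)) = {1..int (Suc m)}"
    using distinct_card[OF dist] len by (intro card_subset_eq sub) (auto simp: extend_def)
  with dist show "extend (xs, v) \<in> permutations_of_set {1..int (Suc m)}"
    by (simp add: permutations_of_set_def)
  have "similar (map ?f xs) xs"
    by (rule similar_map_strict_mono_on) (auto simp: strict_mono_on_def)
  then show "similar (take m (extend (xs, v))) xs" by (simp add: extend_def len)
qed

definition spoiled_extensions :: "nat \<Rightarrow> nat \<Rightarrow> int list set" where
  "spoiled_extensions k m =
     {xs \<in> permutations_of_set {1..int (Suc m)}. twin_free k (take m xs) \<and> \<not> twin_free k xs}"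

lemma finite_spoiled_extensions [simp]: "finite (spoiled_extensions k m)"
  by (simp add: spoiled_extensions_def)

text \<open>
  Every twin-free permutation of \<open>[m]\<close> has \<open>m + 1\<close> extensions, and each of them is either
  twin-free or spoiled.
\<close>

lemma card_extensions_le:
  "Suc m * card (twin_free_perms k m)
     \<le> card (twin_free_perms k (Suc m)) + card (spoiled_extensions k m)"
proof -
  let ?D = "twin_free_perms k m \<times> {1..int (Suc m)}"
  have "extend ` ?D \<subseteq> twin_free_perms k (Suc m) \<union> spoiled_extensions k m"
  proof safe
    fix xs v assume xs: "xs \<in> twin_free_perms k m" and v: "v \<in> {1..int (Suc m)}"
      and no: "extend (xs, v) \<notin> spoiled_extensions k m"
    have "twin_free k (take m (extend (xs, v)))"
      using xs extend_in_permutations(2)[OF _ v] twin_free_similar similar_sym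
      by (metis (no_types, lifting) mem_Collect_eq twin_free_perms_def)
    with xs v no extend_in_permutations(1)[OF _ v] show "extend (xs, v) \<in> twin_free_perms k (Suc m)"
      by (auto simp: twin_free_perms_def spoiled_extensions_def)
  qed
  then have "card (extend ` ?D) \<le> card (twin_free_perms k (Suc m) \<union> spoiled_extensions k m)"
    by (intro card_mono) auto
  also have "\<dots> \<le> card (twin_free_perms k (Suc m)) + card (spoiled_extensions k m)"
    by (rule card_Un_le)
  also have "card (extend ` ?D) = Suc m * card (twin_free_perms k m)"
    by (subst card_image) (auto intro: inj_on_subset[OF inj_extend] simp: card_cartesian_product simp del: of_nat_Suc)
  finally show ?thesis .
qed

text \<open>
  Twins that avoid the last position would already be twins of the twin-free prefix.
\<close>

lemma spoiled_extension_last_block: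
  assumes k: "k \<ge> 1" and xs: "xs \<in> spoiled_extensions k m"
  obtains s where "s + 2 * k \<le> Suc m"
    and "similar (block xs s k) (block xs (Suc m - k) k)"
proof -
  have len: "length xs = Suc m" using xs by (intro length_permutation) (simp add: spoiled_extensions_def)
  obtain s t where st: "s + k \<le> t" "t + k \<le> Suc m" "similar (block xs s k) (block xs t k)"
    using xs len by (auto simp: spoiled_extensions_def twin_free_def)
  have "\<not> t + k \<le> m"
  proof
    assume tm: "t + k \<le> m"
    moreover have "twin_free k (take m xs)" using xs by (simp add: spoiled_extensions_def)
    ultimately show False
      using st len by (auto simp: twin_free_def block_take dest!: spec[of _ s] spec[of _ t])
  qed
  then have "t = Suc m - k" using st by auto
  with st that[of s] show ?thesis by auto
qed

text \<open>
  For each position \<open>s\<close> of the first twin, the map \<open>code\<close> in the proof records the pattern of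
  everything before the last block and the set of values in the last block. Nothing is lost: the
  values before the last block form the complement of that set, so the pattern determines the
  whole prefix; the prefix contains the block at \<open>s\<close>, whose pattern is that of the last block, so the
  last block is determined too. The pattern of the last block is thus not counted, which saves the
  factor \<open>k!\<close>.
\<close>

lemma card_spoiled_extensions_le:
  assumes k: "k \<ge> 1" "k \<le> Suc m"
  shows "card (spoiled_extensions k m)
           \<le> Suc m * (card (twin_free_perms k (Suc m - k)) * (Suc m choose k))"
proof -
  define j where "j = Suc m - k"
  have j: "j \<le> m" "j + k = Suc m" using k by (auto simp: j_def)
  let ?subs = "{A. A \<subseteq> {1..int (Suc m)} \<and> card A = k}"
  define B where "B s = {xs \<in> spoiled_extensions k m. s + 2 * k \<le> Suc m \<and>
      similar (block xs s k) (block xs j k)}" for s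
  define code where "code xs = (standardize (take j xs), set (drop j xs))" for xs
  have props: "distinct xs" "set xs = {1..int (Suc m)}" "length xs = Suc m" "twin_free k (take m xs)"
    if "xs \<in> spoiled_extensions k m" for xs
    using that permutations_of_setD[of xs] length_permutation[of xs "Suc m"]
    by (auto simp: spoiled_extensions_def)
  have "card (B s) \<le> card (twin_free_perms k j) * (Suc m choose k)" for s
  proof -
    have inj: "inj_on code (B s)"
    proof (rule inj_onI)
      fix xs ys assume mem: "xs \<in> B s" "ys \<in> B s" and eq: "code xs = code ys"
      note px = props[of xs] and py = props[of ys]
      have mem': "xs \<in> spoiled_extensions k m" "ys \<in> spoiled_extensions k m"
        and simx: "similar (block xs s k) (block xs j k)"
        and simy: "similar (block ys s k) (block ys j k)" and s: "s + 2 * k \<le> Suc m"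
        using mem by (auto simp: B_def)
      have drops: "set (drop j xs) = set (drop j ys)"
        and std: "standardize (take j xs) = standardize (take j ys)"
        using eq by (auto simp: code_def)
      have sim: "similar (take j xs) (take j ys)"
        using std similar_standardize similar_sym similar_trans by metis
      have compl: "set (take j zs) = {1..int (Suc m)} - set (drop j zs)"
        if "zs \<in> spoiled_extensions k m" for zs
        using props(1,2)[OF that] append_take_drop_id[of j zs]
        by (metis distinct_append set_append Un_Diff_Int Diff_cancel Diff_triv Un_Diff Un_empty_right)
      have "take j xs = take j ys"
        using sim px(1) py(1) mem' drops compl by (intro similar_imp_eq) auto
      moreover have "drop j xs = drop j ys"
      proof (rule similar_imp_eq)
        have "s + k \<le> j" using s j by simp
        then have "similar (block xs s k) (block ys s k)"
          using similar_block[OF sim, of s k] by (simp add: block_take)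
        moreover have "block zs j k = drop j zs" if "zs \<in> spoiled_extensions k m" for zs
          using props(3)[OF that] j by (simp add: block_def)
        ultimately show "similar (drop j xs) (drop j ys)"
          using simx simy mem' similar_sym similar_trans by metis
      qed (use px py mem' drops in auto)
      ultimately show "xs = ys" by (metis append_take_drop_id)
    qed
    have "code ` B s \<subseteq> twin_free_perms k j \<times> ?subs"
    proof (rule image_subsetI)
      fix xs assume "xs \<in> B s"
      then have mem: "xs \<in> spoiled_extensions k m" by (simp add: B_def)
      note p = props[OF mem]
      have "twin_free k (take j xs)"
        using twin_free_take[OF p(4), of j] j by (simp add: min_def)
      then have "twin_free k (standardize (take j xs))"
        using twin_free_similar similar_standardize similar_sym by metis
      moreover have "standardize (take j xs) \<in> permutations_of_set {1..int j}"
        using standardize_in_permutations[of "take j xs"] p j by (simp add: min_def)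
      moreover have "card (set (drop j xs)) = k"
        using distinct_card[of "drop j xs"] p j by simp
      moreover have "set (drop j xs) \<subseteq> {1..int (Suc m)}"
        using p(2) set_drop_subset by metis
      ultimately show "code xs \<in> twin_free_perms k j \<times> ?subs"
        by (simp add: code_def twin_free_perms_def)
    qed
    then have "card (B s) \<le> card (twin_free_perms k j \<times> ?subs)"
      using inj by (intro card_inj_on_le) auto
    also have "\<dots> = card (twin_free_perms k j) * (Suc m choose k)"
      using n_subsets[of "{1..int (Suc m)}" k] by (simp add: card_cartesian_product del: of_nat_Suc)
    finally show ?thesis .
  qed
  note B_le = this
  have "spoiled_extensions k m \<subseteq> (\<Union>s\<in>{..m}. B s)"
  proof
    fix xs assume xs: "xs \<in> spoiled_extensions k m"
    obtain s where "s + 2 * k \<le> Suc m" "similar (block xs s k) (block xs j k)"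
      using spoiled_extension_last_block[OF k(1) xs] unfolding j_def by blast
    with xs k(1) show "xs \<in> (\<Union>s\<in>{..m}. B s)" by (auto simp: B_def intro!: exI[of _ s])
  qed
  \<comment> \<open>The positions \<open>s\<close> that occur lie in \<open>{..m}\<close>, so there are at most \<open>m + 1\<close> of them.\<close>
  then have "card (spoiled_extensions k m) \<le> card (\<Union>s\<in>{..m}. B s)"
    by (intro card_mono) (auto simp: B_def)
  also have "\<dots> \<le> (\<Sum>s\<in>{..m}. card (B s))" by (rule card_UN_le) simp
  also have "\<dots> \<le> (\<Sum>s\<in>{..m}. card (twin_free_perms k j) * (Suc m choose k))"
    by (intro sum_mono B_le)
  also have "\<dots> = Suc m * (card (twin_free_perms k j) * (Suc m choose k))" by simp
  finally show ?thesis by (simp only: j_def)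
qed

text \<open>
  The product of \<open>d\<close> consecutive growth inequalities, written without division: the factors
  \<open>j + 1, \<dots>, j + d\<close> multiply to \<open>(j + d)! / j!\<close>.
\<close>

lemma growth_iterate:
  fixes g :: "nat \<Rightarrow> nat"
  assumes "\<And>i. i < j + d \<Longrightarrow> Suc i * g i \<le> 2 * g (Suc i)"
  shows "g j * fact (j + d) \<le> 2 ^ d * fact j * g (j + d)"
  using assms
proof (induction d)
  case (Suc d)
  have "g j * fact (j + Suc d) = Suc (j + d) * (g j * fact (j + d))" by (simp add: algebra_simps)
  also have "\<dots> \<le> Suc (j + d) * (2 ^ d * fact j * g (j + d))"
    using Suc by (intro mult_left_mono) auto
  also have "\<dots> = 2 ^ d * fact j * (Suc (j + d) * g (j + d))" by (simp only: ac_simps)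
  also have "\<dots> \<le> 2 ^ d * fact j * (2 * g (Suc (j + d)))"
    using Suc.prems[of "j + d"] by (intro mult_left_mono) auto
  finally show ?case by (simp add: ac_simps)
qed simp

text \<open>
  Write \<open>g i\<close> for the number of twin-free permutations of \<open>[i]\<close>, and let \<open>j = m + 1 - k\<close>. The
  induction hypothesis, iterated from \<open>j\<close> to \<open>m\<close>, bounds \<open>g j\<close> by \<open>2\<^bsup>k-1\<^esup> (j! / m!) g m\<close>. Inserted into
  the bound on spoiled extensions, \<open>j! / m!\<close> turns the binomial coefficient into \<open>(m + 1) / k!\<close>,
  which leaves at most \<open>(m + 1)\<^sup>2 2\<^bsup>k-1\<^esup> g m / k!\<close> spoiled extensions. By the assumption on \<open>m\<close> this is at most
  half of the \<open>(m + 1) g m\<close> extensions.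
\<close>

lemma twin_free_perms_growth:
  assumes k: "k \<ge> 1"
  shows "Suc m * 2 ^ k \<le> fact k \<Longrightarrow>
    Suc m * card (twin_free_perms k m) \<le> 2 * card (twin_free_perms k (Suc m))"
proof (induction m rule: less_induct)
  case (less m)
  define g where "g i = card (twin_free_perms k i)" for i
  define b where "b = card (spoiled_extensions k m)"
  have half: "2 * b \<le> Suc m * g m"
  proof (cases "k \<le> Suc m")
    case False
    \<comment> \<open>Too short to contain any block of length \<open>k\<close>.\<close>
    have "spoiled_extensions k m = {}"
    proof (rule ccontr)
      assume "spoiled_extensions k m \<noteq> {}"
      then obtain xs where "xs \<in> spoiled_extensions k m" by blast
      then obtain s where "s + 2 * k \<le> Suc m" by (rule spoiled_extension_last_block[OF k])
      with False show False by simp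
    qed
    then show ?thesis by (simp add: b_def)
  next
    case True
    define j where "j = Suc m - k"
    define d where "d = k - 1"
    have jd: "j + d = m" "j + k = Suc m" "k = Suc d" using True k by (auto simp: j_def d_def)
    have step: "Suc i * g i \<le> 2 * g (Suc i)" if "i < j + d" for i
      unfolding g_def
    proof (rule less.IH)
      show "i < m" using that jd by simp
      have "Suc i * 2 ^ k \<le> Suc m * 2 ^ k" using that jd by (intro mult_right_mono) auto
      from this less.prems show "Suc i * 2 ^ k \<le> fact k" by (rule order_trans)
    qed
    have iter: "g j * fact m \<le> 2 ^ d * fact j * g m"
      using growth_iterate[of j d g, OF step] jd by simp
    have binom: "fact k * fact j * (Suc m choose k) = fact (Suc m)"
      using binomial_fact_lemma[OF True] by (simp add: j_def)
    have b: "b \<le> Suc m * (g j * (Suc m choose k))"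
      unfolding b_def g_def j_def by (rule card_spoiled_extensions_le[OF k True])
    have "(2 * b) * (fact k * fact j) \<le> 2 * (Suc m * (g j * (Suc m choose k))) * (fact k * fact j)"
      using b by (intro mult_right_mono) auto
    also have "\<dots> = 2 * Suc m * g j * (fact k * fact j * (Suc m choose k))" by (simp only: ac_simps)
    also have "\<dots> = 2 * Suc m * Suc m * (g j * fact m)"
      unfolding binom by (simp only: fact_Suc of_nat_id ac_simps)
    also have "\<dots> \<le> 2 * Suc m * Suc m * (2 ^ d * fact j * g m)"
      using iter by (rule mult_left_mono) simp
    also have "\<dots> = (Suc m * 2 ^ k) * (Suc m * g m * fact j)"
      by (simp only: jd(3) power_Suc ac_simps)
    also have "\<dots> \<le> fact k * (Suc m * g m * fact j)"
      using less.prems by (rule mult_right_mono) simp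
    also have "\<dots> = (Suc m * g m) * (fact k * fact j)" by (simp only: ac_simps)
    finally show ?thesis by (simp only: mult_le_cancel2) simp
  qed
  have "Suc m * g m \<le> g (Suc m) + b"
    unfolding g_def b_def by (rule card_extensions_le)
  with half show ?case unfolding g_def by linarith
qed

lemma exists_twin_free_permutation:
  assumes k: "k \<ge> 1" and n: "n * 2 ^ k \<le> fact k"
  shows "\<exists>xs \<in> permutations_of_set {1..int n}. twin_free k xs"
proof -
  have "card (twin_free_perms k m) > 0" if "m \<le> n" for m
    using that
  proof (induction m)
    case 0
    have "twin_free_perms k 0 = {[]}" using k by (auto simp: twin_free_perms_def twin_free_def)
    then show ?case by simp
  next
    case (Suc m)
    have "Suc m * 2 ^ k \<le> n * 2 ^ k" using Suc.prems by (intro mult_right_mono) auto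
    then have "Suc m * card (twin_free_perms k m) \<le> 2 * card (twin_free_perms k (Suc m))"
      using n by (intro twin_free_perms_growth k) linarith
    moreover have "0 < Suc m * card (twin_free_perms k m)" using Suc by simp
    ultimately show ?case by linarith
  qed
  then have "twin_free_perms k n \<noteq> {}" by fastforce
  then show ?thesis by (auto simp: twin_free_perms_def)
qed

text \<open>
  Among \<open>r \<ge> 2\<close> twins there are two, and cutting both blocks down to their first \<open>k\<close> entries keeps
  them disjoint and similar.
\<close>

lemma twin_free_imp_bt_less:
  assumes free: "twin_free k xs" and r: "r \<ge> 2" and len: "r \<le> length xs"
  shows "bt r xs < k"
proof (rule ccontr)
  define l where "l = bt r xs"
  assume "\<not> bt r xs < k"
  then have kl: "k \<le> l" by (simp add: l_def)
  have "has_block_twins r l xs" unfolding l_def using r len by (intro bt_attained(1)) auto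
  then obtain S where l: "l \<ge> 1" and S: "card S = r" "\<forall>s\<in>S. s + l \<le> length xs"
    "pairwise (\<lambda>s t. {s..<s + l} \<inter> {t..<t + l} = {}) S"
    "pairwise (\<lambda>s t. similar (block xs s l) (block xs t l)) S"
    unfolding has_block_twins_def by blast
  have "\<not> card S \<le> 1" using r S(1) by simp
  then obtain s t where st: "s \<in> S" "t \<in> S" "s < t"
    by (metis card_le_Suc0_iff_eq One_nat_def card.infinite le0 linorder_neqE_nat)
  have "{s..<s + l} \<inter> {t..<t + l} = {}" using S(3) st by (auto simp: pairwise_def)
  then have "t \<notin> {s..<s + l}" using l by (auto simp: disjoint_iff)
  then have sep: "s + l \<le> t" using st by simp
  have sim: "similar (block xs s l) (block xs t l)" using S(4) st by (auto simp: pairwise_def)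
  have "block xs u k = take k (block xs u l)" for u using kl by (simp add: block_def min_def)
  then have "similar (block xs s k) (block xs t k)" using similar_take[OF sim] by simp
  moreover have "s + k \<le> t" "t + k \<le> length xs" using sep kl S(2) st by force+
  ultimately show False using free by (auto simp: twin_free_def)
qed

lemma bt_min_less:
  assumes "r \<ge> 2" "n \<ge> r" "k \<ge> 1" "n * 2 ^ k \<le> fact k"
  shows "bt_min r n < k"
proof -
  obtain xs where xs: "xs \<in> permutations_of_set {1..int n}" "twin_free k xs"
    using exists_twin_free_permutation assms by blast
  have "bt_min r n \<le> bt r xs" unfolding bt_min_def using xs(1) by (intro Min_le) auto
  also have "\<dots> < k"
    using xs assms length_permutation[OF xs(1)] by (intro twin_free_imp_bt_less) auto
  finally show ?thesis .
qed

section \<open>Asymptotics\<close>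

text \<open>
  The logarithm of \<open>k! \<ge> (k / e)\<^sup>k\<close>, which holds because \<open>k\<^sup>k / k!\<close> is one of the terms of the
  exponential series for \<open>e\<^sup>k\<close>.
\<close>

lemma ln_fact_ge:
  fixes k :: nat
  assumes "k \<ge> 1"
  shows "real k * (ln (real k) - 1) \<le> ln (fact k)"
proof -
  have "real k ^ k / fact k \<le> exp (real k)"
  proof -
    have "(\<lambda>n. real k ^ n /\<^sub>R fact n) sums exp (real k)" by (rule exp_converges)
    then have "(\<Sum>n\<in>{k}. real k ^ n /\<^sub>R fact n) \<le> exp (real k)"
      by (subst sums_unique[OF \<open>_ sums _\<close>], intro sum_le_suminf) (auto simp: sums_iff)
    then show ?thesis by (simp add: field_simps)
  qed
  then have "real k ^ k \<le> exp (real k) * fact k" by (simp add: field_simps)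
  then have "ln (real k ^ k) \<le> ln (exp (real k) * fact k)"
    using assms by (intro ln_mono) auto
  then show ?thesis using assms by (simp add: ln_realpow ln_mult algebra_simps)
qed

text \<open>
  With \<open>x = (1 + \<epsilon>) ln n / ln (ln n)\<close> the product \<open>x ln x\<close> is \<open>(1 + \<epsilon> + o(1)) ln n\<close>. The surplus
  \<open>\<epsilon> ln n\<close> dominates \<open>2 x\<close>, which pays for the error in \<open>ln (k!)\<close> and for the factor \<open>2\<^sup>k\<close>.
\<close>

lemma bt_min_upper:
  fixes \<epsilon> :: real
  assumes r: "r \<ge> 2" and \<epsilon>: "\<epsilon> > 0"
  shows "\<forall>\<^sub>F n in at_top. real (bt_min r n) \<le> (1 + \<epsilon>) * (ln (real n) / ln (ln (real n))) + 1"
proof -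
  define x where "x n = (1 + \<epsilon>) * (ln (real n) / ln (ln (real n)))" for n :: nat
  have 1: "\<forall>\<^sub>F n in at_top. ln (real n) \<le> x n * (ln (x n) - 2)"
    unfolding x_def using \<epsilon> by real_asymp
  have 2: "\<forall>\<^sub>F n in at_top. x n \<ge> exp 2" unfolding x_def using \<epsilon> by real_asymp
  show ?thesis
    using 1 2 eventually_ge_at_top[of r]
  proof eventually_elim
    case (elim n)
    define k where "k = nat \<lceil>x n\<rceil>"
    have x: "x n > 0" using elim(2) exp_gt_zero[of "2::real"] by linarith
    have k: "real k \<ge> x n" "real k \<le> x n + 1" "k \<ge> 1" using x by (auto simp: k_def) linarith+
    have lnx: "ln (x n) \<ge> 2" using elim(2) x by (simp add: ln_ge_iff)
    have "ln (real n) \<le> x n * (ln (x n) - 2)" by (fact elim(1))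
    also have "\<dots> \<le> real k * (ln (real k) - 2)"
      using k x lnx by (intro mult_mono) auto
    finally have "ln (real n) + real k * 1 \<le> real k * (ln (real k) - 1)" by (simp add: algebra_simps)
    also have "\<dots> \<le> ln (fact k)" using k(3) by (rule ln_fact_ge)
    finally have "ln (real n) + real k * 1 \<le> ln (fact k)" .
    moreover have "real k * ln 2 \<le> real k * 1" using ln_2_less_1 by (intro mult_left_mono) auto
    ultimately have "ln (real n * 2 ^ k) \<le> ln (fact k)"
      using elim(3) r by (simp add: ln_mult ln_realpow)
    then have "real n * 2 ^ k \<le> fact k" using elim(3) r by (subst (asm) ln_le_cancel_iff) auto
    then have "real (n * 2 ^ k) \<le> real (fact k)" by simp
    then have "n * 2 ^ k \<le> fact k" by (simp only: of_nat_le_iff)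
    then have "bt_min r n < k" using r elim(3) k(3) by (intro bt_min_less)
    then show ?case using k(2) by (simp add: x_def)
  qed
qed

text \<open>
  With \<open>x = (1 - \<epsilon>) ln n / ln (ln n)\<close> the bound \<open>ln x \<le> ln (ln n)\<close> gives \<open>x ln x \<le> (1 - \<epsilon>) ln n\<close>. The
  remaining \<open>\<epsilon> ln n\<close> absorbs the factors \<open>r\<close> and \<open>k\<close> of \<open>r k k!\<close>, as \<open>k! \<le> k\<^sup>k\<close>.
\<close>

lemma bt_min_lower:
  fixes \<epsilon> :: real
  assumes r: "r \<ge> 1" and \<epsilon>: "\<epsilon> > 0" "\<epsilon> < 1"
  shows "\<forall>\<^sub>F n in at_top. real (bt_min r n) \<ge> (1 - \<epsilon>) * (ln (real n) / ln (ln (real n))) - 1"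
proof -
  define x where "x n = (1 - \<epsilon>) * (ln (real n) / ln (ln (real n)))" for n :: nat
  have "\<forall>\<^sub>F n in at_top. C + ln (ln (real n)) \<le> \<epsilon> * ln (real n)" for C
    using \<epsilon> by real_asymp
  from this[of "ln (real r)"]
  have small: "\<forall>\<^sub>F n in at_top. ln (real r) + ln (ln (real n)) \<le> \<epsilon> * ln (real n)" .
  have M: "\<forall>\<^sub>F n in at_top. ln (ln (real n)) \<ge> 1" by real_asymp
  have 2: "\<forall>\<^sub>F n in at_top. x n \<ge> 1" unfolding x_def using \<epsilon> by real_asymp
  have 1: "\<forall>\<^sub>F n in at_top. ln (real r) + ln (x n) + x n * ln (x n) \<le> ln (real n)"
    using small M 2 eventually_gt_at_top[of 1]
  proof eventually_elim
    case (elim n)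
    have pos: "ln (real n) > 0" using elim(4) by simp
    have xM: "x n * ln (ln (real n)) = (1 - \<epsilon>) * ln (real n)"
      using elim(2) by (simp add: x_def)
    have "x n * 1 \<le> x n * ln (ln (real n))" using elim(2,3) by (intro mult_left_mono) auto
    also have "\<dots> \<le> 1 * ln (real n)" unfolding xM using \<epsilon> pos by (intro mult_right_mono) auto
    finally have "ln (x n) \<le> ln (ln (real n))" using elim(3) by simp
    moreover from this have "x n * ln (x n) \<le> (1 - \<epsilon>) * ln (real n)"
      unfolding xM[symmetric] using elim(3) by (intro mult_left_mono) auto
    ultimately show ?case using elim(1) by (simp add: algebra_simps)
  qed
  show ?thesis
    using 1 2 eventually_ge_at_top[of 1]
  proof eventually_elim
    case (elim n)
    define k where "k = nat \<lfloor>x n\<rfloor>"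
    have k: "real k \<le> x n" "real k \<ge> x n - 1" "k \<ge> 1" using elim(2) by (auto simp: k_def) linarith+
    have "fact k \<le> real k ^ k" using fact_le_power[of k, where 'a=real] by simp
    then have "real r * real k * fact k \<le> real r * real k * real k ^ k"
      by (intro mult_left_mono) auto
    then have "ln (real r * real k * fact k) \<le> ln (real r * real k * real k ^ k)"
      using r k by (intro ln_mono) auto
    also have "\<dots> = ln (real r) + ln (real k) + real k * ln (real k)"
      using r k by (simp add: ln_mult ln_realpow)
    also have "\<dots> \<le> ln (real r) + ln (x n) + x n * ln (x n)"
      using k elim(2) by (intro add_mono mult_mono) auto
    also have "\<dots> \<le> ln (real n)" by (fact elim(1))
    finally have "real r * real k * fact k \<le> real n"
      using r k elim(3) by (subst (asm) ln_le_cancel_iff) auto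
    then have "real (r * k * fact k) \<le> real n" by simp
    then have "r * k * fact k \<le> n" by (simp only: of_nat_le_iff)
    then have "k \<le> bt_min r n" using r k by (intro bt_min_ge)
    then show ?case using k(2) by (simp add: x_def)
  qed
qed

theorem theorem3p2:
  fixes r :: nat
  assumes "r \<ge> 2"
  shows "(\<lambda>n. real (bt_min r n)) \<sim>[at_top] (\<lambda>n. ln (real n) / ln (ln (real n)))"
proof (rule asymp_equivI')
  define L where "L n = ln (real n) / ln (ln (real n))" for n :: nat
  have "((\<lambda>n. real (bt_min r n) / L n) \<longlongrightarrow> 1) at_top"
  proof (rule tendstoI)
    fix e :: real assume "e > 0"
    \<comment> \<open>One \<open>\<epsilon>\<close> is spent on the factor \<open>1 \<plusminus> \<epsilon>\<close>, a second one on the additive error 1 from rounding.\<close>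
    define \<epsilon> where "\<epsilon> = min e 1 / 3"
    have \<epsilon>: "\<epsilon> > 0" "\<epsilon> < 1" "2 * \<epsilon> < e" using \<open>e > 0\<close> by (auto simp: \<epsilon>_def)
    have "\<forall>\<^sub>F n in at_top. real (bt_min r n) \<le> (1 + \<epsilon>) * L n + 1"
      using bt_min_upper[OF assms \<epsilon>(1)] by (simp add: L_def)
    moreover have "\<forall>\<^sub>F n in at_top. real (bt_min r n) \<ge> (1 - \<epsilon>) * L n - 1"
      using bt_min_lower[OF _ \<epsilon>(1,2)] assms by (simp add: L_def)
    moreover have "\<forall>\<^sub>F n in at_top. L n \<ge> 1 / \<epsilon>" unfolding L_def using \<epsilon> by real_asymp
    ultimately show "\<forall>\<^sub>F n in at_top. dist (real (bt_min r n) / L n) 1 < e"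
    proof eventually_elim
      case (elim n)
      have L: "L n > 0" using elim(3) \<epsilon>(1) by (meson divide_pos_pos less_le_trans zero_less_one)
      have "\<epsilon> * L n \<ge> 1" using elim(3) \<epsilon>(1) by (simp add: field_simps)
      then have "\<bar>real (bt_min r n) - L n\<bar> \<le> 2 * \<epsilon> * L n"
        using elim(1,2) by (simp add: algebra_simps abs_le_iff)
      also have "\<dots> < e * L n" using \<epsilon>(3) L by simp
      finally have "\<bar>real (bt_min r n) - L n\<bar> / L n < e" using L by (simp add: field_simps)
      moreover have "dist (real (bt_min r n) / L n) 1 = \<bar>real (bt_min r n) - L n\<bar> / L n"
        using L by (simp add: dist_real_def field_simps)
      ultimately show ?case by simp
    qed
  qed
  then show "((\<lambda>n. real (bt_min r n) / (ln (real n) / ln (ln (real n)))) \<longlongrightarrow> 1) at_top"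
    by (simp only: L_def)
qed

end
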